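(* Let $A=M-N$ be a weak proper splitting of the first type of $A\in\mathbb{R}^{m\times n}$. For $\lambda>0$, let $B_\lambda=A^TA+\lambda I$ and let $B_\lambda=M_\lambda-N_\lambda$ be a weak splitting of the first type of $B_\lambda\in\mathbb{R}^{n\times n}$. If $A^\dagger N\ge \lim_{\lambda\to 0}B_\lambda^{-1}N_\lambda\ge 0$, then $$\lim_{\lambda\to 0}\rho(M_\lambda^{-1}N_\lambda)\le \rho(M^\dagger N)<1.$$
   Context: Matrix inequalities are entrywise. $X^\dagger$ is the Moore-Penrose inverse, $\rho$ the spectral radius, $R(\cdot)$ and $N(\cdot)$ applied to a matrix denote range and null space. A decomposition $A=M-N$ of $A\in\mathbb{R}^{m\times n}$ is a proper splitting if $A$ and $M$ have the same range and the same null space; it is a weak proper splitting of the first type if moreover $M^\dagger N\ge 0$. For nonsingular $B\in\mathbb{R}^{n\times n}$, a decomposition $B=U-V$ with $U$ nonsingular is a weak splitting of the first type if $U^{-1}V\ge 0$. $\lim_{\lambda\to0}$ denotes the limit as $\lambda\to 0$ through positive values (entrywise for matrices). *)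

theory Defs
  imports "HOL-Analysis.Analysis"
begin

definition is_moore_penrose :: "real^'n^'m \<Rightarrow> real^'m^'n \<Rightarrow> bool" where
  "is_moore_penrose A X \<longleftrightarrow>
     A ** X ** A = A \<and> X ** A ** X = X \<and>
     transpose (A ** X) = A ** X \<and> transpose (X ** A) = X ** A"

definition moore_penrose :: "real^'n^'m \<Rightarrow> real^'m^'n" where
  "moore_penrose A = (THE X. is_moore_penrose A X)"

definition eigenvalues :: "real^'n^'n \<Rightarrow> complex set" where
  "eigenvalues A = {c. \<exists>v. v \<noteq> 0 \<and> map_matrix complex_of_real A *v v = c *s v}"

text \<open>There are finitely many eigenvalues and at least one, so the supremum is a maximum.\<close>

definition spec_radius :: "real^'n^'n \<Rightarrow> real" where
  "spec_radius A = Sup (cmod ` eigenvalues A)"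

definition proper_splitting :: "real^'n^'m \<Rightarrow> real^'n^'m \<Rightarrow> real^'n^'m \<Rightarrow> bool" where
  "proper_splitting A M N \<longleftrightarrow>
     A = M - N \<and>
     range (\<lambda>x. A *v x) = range (\<lambda>x. M *v x) \<and>
     {x. A *v x = 0} = {x. M *v x = 0}"

text \<open>The order on matrices is the library's componentwise order on \<open>vec\<close>, that is, entrywise.\<close>

definition weak_proper_splitting_first :: "real^'n^'m \<Rightarrow> real^'n^'m \<Rightarrow> real^'n^'m \<Rightarrow> bool" where
  "weak_proper_splitting_first A M N \<longleftrightarrow>
     proper_splitting A M N \<and> moore_penrose M ** N \<ge> 0"

text \<open>Applied only to nonsingular \<open>B\<close>.\<close>

definition weak_splitting_first :: "real^'n^'n \<Rightarrow> real^'n^'n \<Rightarrow> real^'n^'n \<Rightarrow> bool" where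
  "weak_splitting_first B U V \<longleftrightarrow>
     B = U - V \<and> invertible U \<and> matrix_inv U ** V \<ge> 0"

text \<open>\<open>A\<^sup>T A + \<lambda> I\<close>, which is nonsingular for \<open>\<lambda> > 0\<close>.\<close>

definition regularized_gram :: "real^'n^'m \<Rightarrow> real \<Rightarrow> real^'n^'n" where
  "regularized_gram A l = transpose A ** A + l *\<^sub>R mat 1"

text \<open>The four Penrose equations have exactly one solution, so \<open>moore_penrose\<close> is well defined.\<close>

lemma is_moore_penrose_unique:
  fixes A :: "real^'n^'m"
  assumes X: "is_moore_penrose A X" and Y: "is_moore_penrose A Y"
  shows "X = Y"
proof -
  have AX: "A ** X ** A = A" "X ** A ** X = X"
    and sX: "transpose X ** transpose A = A ** X" "transpose A ** transpose X = X ** A"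
    using X by (auto simp: is_moore_penrose_def matrix_transpose_mul)
  have AY: "A ** Y ** A = A" "Y ** A ** Y = Y"
    and sY: "transpose Y ** transpose A = A ** Y" "transpose A ** transpose Y = Y ** A"
    using Y by (auto simp: is_moore_penrose_def matrix_transpose_mul)
  have tX: "transpose A ** transpose X ** transpose A = transpose A"
    using arg_cong[OF AX(1), of transpose] by (simp add: matrix_transpose_mul matrix_mul_assoc)
  have tY: "transpose A ** transpose Y ** transpose A = transpose A"
    using arg_cong[OF AY(1), of transpose] by (simp add: matrix_transpose_mul matrix_mul_assoc)
  have "A ** X = transpose X ** (transpose A ** transpose Y ** transpose A)"
    using sX(1) tY by simp
  also have "\<dots> = (A ** X) ** (A ** Y)"
    by (metis matrix_mul_assoc sX(1) sY(1))
  also have "\<dots> = A ** Y" using AX(1) by (simp add: matrix_mul_assoc)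
  finally have 1: "A ** X = A ** Y" .
  have "X ** A = (transpose A ** transpose Y ** transpose A) ** transpose X"
    using sX(2) tY by simp
  also have "\<dots> = (Y ** A) ** (X ** A)"
    by (metis matrix_mul_assoc sX(2) sY(2))
  also have "\<dots> = Y ** A" using AX(1) by (metis matrix_mul_assoc)
  finally have 2: "X ** A = Y ** A" .
  show ?thesis using 1 2 AX(2) AY(2) by (metis matrix_mul_assoc)
qed

lemma matrix_mul_diff_right:
  fixes A :: "real^'n^'m" and Y Z :: "real^'k^'n"
  shows "A ** (Y - Z) = A ** Y - A ** Z"
  by (simp add: matrix_matrix_mult_def vec_eq_iff sum_subtractf right_diff_distrib)

lemma gram_cancel:
  fixes A :: "real^'n^'m" and Z :: "real^'k^'n"
  assumes "transpose A ** (A ** Z) = 0"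
  shows "A ** Z = 0"
proof -
  have "(A ** Z) *v x = 0" for x
  proof -
    let ?y = "A *v (Z *v x)"
    have "transpose A *v ?y = 0"
      using assms by (metis matrix_vector_mul_assoc matrix_vector_mult_0)
    then have "?y \<bullet> ?y = 0"
      by (metis dot_lmul_matrix inner_commute inner_zero_left transpose_matrix_vector)
    then show ?thesis by (simp add: matrix_vector_mul_assoc)
  qed
  then show ?thesis by (simp add: matrix_eq)
qed

lemma ex_range_projection:
  fixes A :: "real^'n^'m"
  shows "\<exists>G. transpose (A ** G ** transpose A) = A ** G ** transpose A \<and>
             A ** G ** transpose A ** A = A"
proof -
  let ?H = "transpose A ** A"
  obtain g where g: "linear g" "\<And>x. ?H *v (g (?H *v x)) = ?H *v x"
    using linear_exists_right_inverse_on[of "(*v) ?H" UNIV] by auto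
  define G where "G = matrix g"
  have "G *v x = g x" for x
    unfolding G_def using g(1) by (simp add: matrix_works)
  with g(2) have HG: "?H ** G ** ?H = ?H"
    by (simp add: matrix_eq flip: matrix_vector_mul_assoc)
  have tHG: "?H ** transpose G ** ?H = ?H"
    using arg_cong[OF HG, of transpose] by (simp add: matrix_transpose_mul matrix_mul_assoc)
  have *: "A ** K ** transpose A ** A = A" if "?H ** K ** ?H = ?H" for K
  proof -
    have "transpose A ** (A ** (K ** ?H - mat 1)) = 0"
      using that by (simp add: matrix_mul_diff_right matrix_mul_assoc)
    then have "A ** (K ** ?H - mat 1) = 0" by (rule gram_cancel)
    then show ?thesis by (simp add: matrix_mul_diff_right matrix_mul_assoc)
  qed
  let ?P = "A ** G ** transpose A"
  have tP: "transpose ?P = A ** transpose G ** transpose A"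
    by (simp add: matrix_transpose_mul matrix_mul_assoc)
  have "transpose ?P ** ?P = ?P"
    using *[OF tHG] unfolding tP by (metis matrix_mul_assoc)
  then have "transpose ?P = ?P"
    by (metis matrix_transpose_mul transpose_transpose)
  with *[OF HG] show ?thesis by blast
qed

lemma ex_is_moore_penrose:
  fixes A :: "real^'n^'m"
  shows "\<exists>X. is_moore_penrose A X"
proof -
  obtain G where G: "transpose (A ** G ** transpose A) = A ** G ** transpose A"
      "A ** G ** transpose A ** A = A"
    using ex_range_projection[of A] by blast
  obtain K where K: "transpose (transpose A ** K ** A) = transpose A ** K ** A"
      "transpose A ** K ** A ** transpose A = transpose A"
    using ex_range_projection[of "transpose A"] by auto
  have K': "A ** (transpose A ** K ** A) = A"
    using arg_cong[OF K(2), of transpose] K(1)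
    by (metis matrix_transpose_mul transpose_transpose)
  let ?X = "transpose A ** K ** A ** G ** transpose A"
  have AX: "A ** ?X = A ** G ** transpose A"
    using K' by (metis matrix_mul_assoc)
  have XA: "?X ** A = transpose A ** K ** A"
    using G(2) by (metis matrix_mul_assoc)
  have "?X ** A ** ?X = ?X"
    unfolding XA using K(2) by (metis matrix_mul_assoc)
  with AX XA G K have "is_moore_penrose A ?X"
    unfolding is_moore_penrose_def by simp
  then show ?thesis by blast
qed

lemma is_moore_penrose_moore_penrose: "is_moore_penrose A (moore_penrose A)"
  unfolding moore_penrose_def
  by (rule theI') (use ex_is_moore_penrose is_moore_penrose_unique in blast)

end

theory Submission
  imports Defs
begin

text \<open>Write \<open>T = M\<^sup>\<dagger>N\<close> and \<open>C = A\<^sup>\<dagger>N\<close>; for both kinds of splitting \<open>I - T\<close> is injective and \<open>(I - T) C = T\<close>.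
  If \<open>T\<close> and \<open>C\<close> are nonnegative, comparing Perron vectors gives \<open>\<rho>(T) = \<rho>(C) / (1 + \<rho>(C)) < 1\<close>.
  The matrices \<open>C\<^sub>\<lambda> = B\<^sub>\<lambda>\<^sup>-\<^sup>1 N\<^sub>\<lambda>\<close> need not be nonnegative, but as their limit \<open>L\<close> is, their entries are
  eventually above \<open>- 1 / n\<close>; this already excludes \<open>\<rho>(T\<^sub>\<lambda>) \<ge> 1\<close>, and then \<open>C\<^sub>\<lambda> \<ge> 0\<close>. By continuity of the
  spectral radius on nonnegative matrices the limit is \<open>\<rho>(L) / (1 + \<rho>(L))\<close>, and \<open>\<rho>\<close> is monotone.\<close>

section \<open>Entrywise order and the standard simplex\<close>

lemma nonneg_matrix_iff:
  fixes A :: "real^'n^'m"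
  shows "A \<ge> 0 \<longleftrightarrow> (\<forall>i j. A $ i $ j \<ge> 0)"
  by (simp add: less_eq_vec_def)

lemma nonneg_matrix_vector_mult:
  fixes A :: "real^'n^'m"
  assumes "A \<ge> 0" "x \<ge> 0"
  shows "A *v x \<ge> 0"
  using assms by (auto simp: less_eq_vec_def matrix_vector_mult_def intro!: sum_nonneg)

lemma nonneg_matrix_vector_mono:
  fixes A :: "real^'n^'m"
  assumes "A \<ge> 0" "x \<ge> y"
  shows "A *v x \<ge> A *v y"
  using assms by (auto simp: less_eq_vec_def matrix_vector_mult_def intro!: sum_mono mult_left_mono)

lemma nonneg_vec_eq_0_iff:
  fixes x :: "real^'n"
  assumes "x \<ge> 0"
  shows "sum (($) x) UNIV = 0 \<longleftrightarrow> x = 0"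
proof -
  have "sum (($) x) UNIV = 0 \<longleftrightarrow> (\<forall>i\<in>UNIV. x $ i = 0)"
    using assms by (intro sum_nonneg_eq_0_iff) (auto simp: less_eq_vec_def)
  then show ?thesis by (auto simp: vec_eq_iff)
qed

lemma closed_nonneg_vec: "closed {x :: real^'n. x \<ge> 0}"
proof -
  have "{x :: real^'n. x \<ge> 0} = (\<Inter>i. {x. x $ i \<ge> 0})"
    by (auto simp: less_eq_vec_def)
  then show ?thesis
    by (auto intro!: closed_INT closed_Collect_le continuous_intros)
qed

lemma compact_simplex_vec: "compact {x :: real^'n. x \<ge> 0 \<and> sum (($) x) UNIV = 1}"
proof -
  have "closed {x :: real^'n. sum (($) x) UNIV = 1}"
    by (intro closed_Collect_eq continuous_intros)
  then have "closed ({x :: real^'n. x \<ge> 0} \<inter> {x. sum (($) x) UNIV = 1})"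
    using closed_nonneg_vec by blast
  moreover have "bounded {x :: real^'n. x \<ge> 0 \<and> sum (($) x) UNIV = 1}"
  proof (rule boundedI)
    fix x :: "real^'n" assume "x \<in> {x. x \<ge> 0 \<and> sum (($) x) UNIV = 1}"
    then show "norm x \<le> 1"
      using norm_le_l1_cart[of x] by (simp add: less_eq_vec_def)
  qed
  ultimately show ?thesis by (simp add: compact_eq_bounded_closed Collect_conj_eq)
qed

section \<open>The Perron-Frobenius theorem for nonnegative matrices\<close>

text \<open>The set of \<open>x\<close> in the simplex with \<open>A x \<ge> \<mu> x\<close> is mapped into itself by the normalized action of
  \<open>A\<close>, so Brouwer's theorem applies to it.\<close>

lemma nonneg_eigenvector_of_subinvariant:
  fixes A :: "real^'n^'n"
  assumes A: "A \<ge> 0" and x: "x \<ge> 0" "x \<noteq> 0" and mu: "\<mu> \<ge> 0" "A *v x \<ge> \<mu> *\<^sub>R x"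
  obtains \<nu> y where "\<nu> \<ge> \<mu>" "y \<ge> 0" "sum (($) y) UNIV = 1" "A *v y = \<nu> *\<^sub>R y"
proof -
  let ?s = "\<lambda>x::real^'n. sum (($) x) UNIV"
  define S where "S = {x. x \<ge> 0 \<and> ?s x = 1} \<inter> {x. A *v x - \<mu> *\<^sub>R x \<ge> 0}"
  have s_pos: "?s y > 0" if "y \<ge> 0" "y \<noteq> 0" for y
    using that nonneg_vec_eq_0_iff[of y] sum_nonneg[of UNIV "($) y"]
    by (force simp: less_eq_vec_def)
  have s_scale: "?s (c *\<^sub>R y) = c * ?s y" for c y
    by (simp add: sum_distrib_left)
  \<comment> \<open>The defining inequality is homogeneous, so scaling to entry sum 1 preserves it.
    This serves both for \<open>S \<noteq> {}\<close> and for the invariance of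
    \<open>S\<close>.\<close>
  have norm_in: "(1 / ?s y) *\<^sub>R y \<in> S" if "y \<ge> 0" "y \<noteq> 0" "A *v y \<ge> \<mu> *\<^sub>R y" for y
  proof -
    note p = s_pos[OF that(1,2)]
    let ?z = "(1 / ?s y) *\<^sub>R y"
    have "A *v ?z - \<mu> *\<^sub>R ?z = (1 / ?s y) *\<^sub>R (A *v y - \<mu> *\<^sub>R y)"
      by (simp add: matrix_vector_mult_scaleR algebra_simps)
    also have "\<dots> \<ge> 0"
      using that p by (auto simp: less_eq_vec_def)
    finally have "A *v ?z - \<mu> *\<^sub>R ?z \<ge> 0" .
    moreover have "?z \<ge> 0" using that p by (auto simp: less_eq_vec_def)
    moreover have "?s ?z = 1" unfolding s_scale using p by simp
    ultimately show ?thesis unfolding S_def by blast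
  qed
  have "compact S"
    unfolding S_def
  proof (intro compact_Int_closed compact_simplex_vec)
    have "{x. A *v x - \<mu> *\<^sub>R x \<ge> 0} = (\<lambda>x. A *v x - \<mu> *\<^sub>R x) -` {x. x \<ge> 0}" by auto
    then show "closed {x. A *v x - \<mu> *\<^sub>R x \<ge> 0}"
      by (simp only:) (intro closed_vimage closed_nonneg_vec continuous_intros
          bounded_linear.continuous_on[OF matrix_vector_mul_bounded_linear])
  qed
  moreover have "convex S"
  proof (rule convexI)
    fix y z :: "real^'n" and u v :: real
    assume *: "y \<in> S" "z \<in> S" "0 \<le> u" "0 \<le> v" "u + v = 1"
    let ?w = "u *\<^sub>R y + v *\<^sub>R z"
    have "A *v ?w - \<mu> *\<^sub>R ?w = u *\<^sub>R (A *v y - \<mu> *\<^sub>R y) + v *\<^sub>R (A *v z - \<mu> *\<^sub>R z)"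
      by (simp add: matrix_vector_mult_scaleR matrix_vector_right_distrib algebra_simps)
    also have "\<dots> \<ge> 0"
      using * unfolding S_def less_eq_vec_def by (auto intro!: add_nonneg_nonneg mult_nonneg_nonneg)
    finally have "A *v ?w - \<mu> *\<^sub>R ?w \<ge> 0" .
    moreover have "?s ?w = 1"
      using * unfolding S_def by (simp add: sum.distrib flip: sum_distrib_left)
    moreover have "?w \<ge> 0"
      using * unfolding S_def by (auto simp: less_eq_vec_def)
    ultimately show "?w \<in> S"
      unfolding S_def by blast
  qed
  moreover have S_ne: "S \<noteq> {}"
    using norm_in[OF x mu(2)] by blast
  ultimately have brou: "\<exists>y\<in>S. f y = y" if "continuous_on S f" "f ` S \<subseteq> S" for f
    using brouwer[of S f] that by (auto simp: image_subset_iff)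
  show ?thesis
  \<comment> \<open>Where \<open>A y = 0\<close> the action cannot be normalized. Then
    \<open>\<mu> y \<le> 0\<close> with \<open>y\<close> nonzero forces \<open>\<mu> = 0\<close>,
    and \<open>y\<close> itself is an eigenvector for 0.\<close>
  proof (cases "\<exists>y\<in>S. A *v y = 0")
    case True
    then obtain y where y: "y \<in> S" "A *v y = 0" by blast
    then have "\<mu> *\<^sub>R y \<le> 0" by (simp add: S_def less_eq_vec_def)
    moreover obtain i where "y $ i > 0"
      using y unfolding S_def less_eq_vec_def
      by (metis (mono_tags, lifting) IntD1 mem_Collect_eq order_le_less sum.neutral zero_index zero_neq_one)
    ultimately have "\<mu> = 0"
      using mu(1) by (auto simp: less_eq_vec_def mult_le_0_iff dest!: spec[of _ i])
    then show ?thesis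
      using y by (intro that[of 0 y]) (auto simp: S_def)
  next
    case False
    let ?f = "\<lambda>y. (1 / ?s (A *v y)) *\<^sub>R (A *v y)"
    have nn: "A *v y \<ge> 0" if "y \<in> S" for y
      using that A by (simp add: S_def nonneg_matrix_vector_mult)
    have "?f ` S \<subseteq> S"
    proof (intro image_subsetI norm_in)
      fix y assume y: "y \<in> S"
      then have "A *v y \<ge> \<mu> *\<^sub>R y" by (simp add: S_def less_eq_vec_def)
      from nonneg_matrix_vector_mono[OF A this]
      show "A *v (A *v y) \<ge> \<mu> *\<^sub>R (A *v y)" by (simp add: matrix_vector_mult_scaleR)
    qed (use nn False in auto)
    moreover have "continuous_on S ?f"
    proof -
      have cA: "continuous_on S (\<lambda>y. A *v y)"
        by (intro bounded_linear.continuous_on[OF matrix_vector_mul_bounded_linear] continuous_intros)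
      have "\<forall>y\<in>S. ?s (A *v y) \<noteq> 0"
        using s_pos[OF nn] False by force
      then show ?thesis
        by (intro continuous_intros cA) auto
    qed
    ultimately obtain y where y: "y \<in> S" "?f y = y" using brou[of ?f] by blast
    let ?nu = "?s (A *v y)"
    have p: "?nu > 0" using s_pos[OF nn] y False by auto
    have eig: "A *v y = ?nu *\<^sub>R y"
      using p by (subst (3) y(2)[symmetric]) simp
    \<comment> \<open>Summing the entries of \<open>\<mu> y \<le> A y\<close> compares the
      eigenvalues, as those of \<open>y\<close> add up to 1.\<close>
    have "?s (\<mu> *\<^sub>R y) \<le> ?nu"
      using y(1) unfolding S_def by (intro sum_mono) (auto simp: less_eq_vec_def)
    then have "\<mu> \<le> ?nu" using y(1) unfolding s_scale S_def by simp
    then show ?thesis using eig y(1) by (intro that[of ?nu y]) (auto simp: S_def)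
  qed
qed

lemma real_eigenvalue_mem:
  fixes A :: "real^'n^'n"
  assumes "A *v x = \<nu> *\<^sub>R x" "x \<noteq> 0"
  shows "complex_of_real \<nu> \<in> eigenvalues A"
proof -
  let ?v = "(\<chi> i. complex_of_real (x $ i))"
  have "?v \<noteq> 0" using assms(2) by (auto simp: vec_eq_iff)
  moreover have "map_matrix complex_of_real A *v ?v = complex_of_real \<nu> *s ?v"
    using arg_cong[OF assms(1), of "\<lambda>y. (\<chi> i. complex_of_real (y $ i))"]
    by (simp add: vec_eq_iff matrix_vector_mult_def map_matrix_def)
  ultimately show ?thesis unfolding eigenvalues_def by blast
qed

text \<open>By the triangle inequality the vector of moduli \<open>|v|\<close> of a complex
  eigenvector satisfies \<open>A |v| \<ge> |c| |v|\<close>, so it is subinvariant.\<close>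

lemma nonneg_eigenvalue_dominates:
  fixes A :: "real^'n^'n"
  assumes A: "A \<ge> 0" and c: "c \<in> eigenvalues A"
  obtains \<nu> y where "\<nu> \<ge> cmod c" "y \<ge> 0" "sum (($) y) UNIV = 1" "A *v y = \<nu> *\<^sub>R y"
proof -
  obtain v where v: "v \<noteq> 0" "map_matrix complex_of_real A *v v = c *s v"
    using c unfolding eigenvalues_def by blast
  let ?w = "\<chi> i. cmod (v $ i)"
  have "cmod c * cmod (v $ i) \<le> (\<Sum>j\<in>UNIV. A $ i $ j * cmod (v $ j))" for i
  proof -
    have "c * v $ i = (\<Sum>j\<in>UNIV. complex_of_real (A $ i $ j) * v $ j)"
      using arg_cong[OF v(2), of "\<lambda>y. y $ i"]
      by (simp add: matrix_vector_mult_def map_matrix_def)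
    then have "cmod c * cmod (v $ i) \<le> (\<Sum>j\<in>UNIV. cmod (complex_of_real (A $ i $ j) * v $ j))"
      by (metis norm_mult norm_sum)
    then show ?thesis
      using A by (simp add: norm_mult nonneg_matrix_iff)
  qed
  then have "A *v ?w \<ge> cmod c *\<^sub>R ?w"
    by (simp add: less_eq_vec_def matrix_vector_mult_def)
  moreover have "?w \<ge> 0" "?w \<noteq> 0" using v(1) by (auto simp: less_eq_vec_def vec_eq_iff)
  ultimately show ?thesis
    using nonneg_eigenvector_of_subinvariant[OF A] that by (metis norm_ge_zero)
qed

text \<open>Eigenpairs with vector in the simplex and eigenvalue at least 0 form a nonempty compact
  set, so one has maximal eigenvalue \<open>r\<close>. Each complex eigenvalue is dominated in
  modulus by the eigenvalue of such a pair, so \<open>r\<close> is the spectral radius.\<close>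

theorem perron_frobenius:
  fixes A :: "real^'n^'n"
  assumes A: "A \<ge> 0"
  shows "\<exists>x. x \<ge> 0 \<and> sum (($) x) UNIV = 1 \<and> A *v x = spec_radius A *\<^sub>R x"
    and "c \<in> eigenvalues A \<Longrightarrow> cmod c \<le> spec_radius A"
    and "spec_radius A \<ge> 0"
proof -
  let ?s = "\<lambda>x::real^'n. sum (($) x) UNIV"
  \<comment> \<open>The sum of all entries bounds these eigenvalues: \<open>\<nu>\<close> is the
    entry sum of \<open>A y\<close>, and no entry of \<open>y\<close> exceeds 1.\<close>
  let ?B = "\<Sum>i\<in>UNIV. \<Sum>j\<in>UNIV. A $ i $ j"
  define K where "K = ({0..?B} \<times> {x. x \<ge> 0 \<and> ?s x = 1}) \<inter> {p. A *v snd p = fst p *\<^sub>R snd p}"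
  have "continuous_on UNIV (\<lambda>p::real \<times> (real^'n). A *v snd p)"
    by (intro bounded_linear.continuous_on[OF matrix_vector_mul_bounded_linear] continuous_intros)
  then have "closed {p. A *v snd p = fst p *\<^sub>R snd p}"
    by (intro closed_Collect_eq continuous_intros)
  then have "compact K"
    unfolding K_def by (intro compact_Int_closed compact_Times compact_simplex_vec) auto
  moreover have K_mem: "(\<nu>, y) \<in> K" if "\<nu> \<ge> 0" "y \<ge> 0" "?s y = 1" "A *v y = \<nu> *\<^sub>R y" for \<nu> y
  proof -
    have le1: "y $ j \<le> 1" for j
      using that(2,3) member_le_sum[of j UNIV "($) y"] by (simp add: less_eq_vec_def)
    have "\<nu> = ?s (A *v y)"
      using that by (simp flip: sum_distrib_left)
    also have "\<dots> \<le> ?B"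
      unfolding matrix_vector_mult_def using A le1
      by (auto intro!: sum_mono mult_left_le simp: nonneg_matrix_iff)
    finally show ?thesis using that by (simp add: K_def)
  qed
  moreover have "K \<noteq> {}"
  proof -
    \<comment> \<open>The all-ones vector is subinvariant for the factor 0.\<close>
    obtain \<nu> y where "\<nu> \<ge> (0::real)" "y \<ge> 0" "?s y = 1" "A *v y = \<nu> *\<^sub>R y"
    proof (rule nonneg_eigenvector_of_subinvariant[OF A, of 1 0])
      show "0 *\<^sub>R 1 \<le> A *v 1" using nonneg_matrix_vector_mult[OF A, of 1] by (simp add: less_eq_vec_def)
    qed (auto simp: less_eq_vec_def vec_eq_iff)
    then show ?thesis using K_mem by blast
  qed
  ultimately obtain p where p: "p \<in> K" "\<And>q. q \<in> K \<Longrightarrow> fst q \<le> fst p"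
    using continuous_attains_sup[of K fst] continuous_on_fst[OF continuous_on_id] by blast
  obtain r x where rx: "p = (r, x)" by force
  have x: "x \<ge> 0" "?s x = 1" "A *v x = r *\<^sub>R x" "r \<ge> 0"
    using p(1) unfolding rx K_def by auto
  have "x \<noteq> 0" using x(2) by auto
  then have mem: "complex_of_real r \<in> eigenvalues A"
    using real_eigenvalue_mem x(3) by blast
  have bound: "cmod c \<le> r" if c: "c \<in> eigenvalues A" for c
  proof -
    obtain \<nu> y where "\<nu> \<ge> cmod c" "y \<ge> 0" "?s y = 1" "A *v y = \<nu> *\<^sub>R y"
      using nonneg_eigenvalue_dominates[OF A c] .
    moreover from this have "(\<nu>, y) \<in> K" by (intro K_mem) (auto intro: order_trans[OF norm_ge_zero])
    ultimately show ?thesis using p(2) rx by fastforce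
  qed
  have "spec_radius A = r"
    unfolding spec_radius_def
  proof (rule cSup_eq_maximum)
    show "r \<in> cmod ` eigenvalues A" using mem x(4) by (force intro!: image_eqI[OF _ mem])
  qed (use bound in auto)
  then show "\<exists>x. x \<ge> 0 \<and> ?s x = 1 \<and> A *v x = spec_radius A *\<^sub>R x"
    and "c \<in> eigenvalues A \<Longrightarrow> cmod c \<le> spec_radius A" and "spec_radius A \<ge> 0"
    using x bound by auto
qed

section \<open>Test vectors and comparison principles for the spectral radius\<close>

lemma real_eigenvalue_le_spec_radius:
  fixes A :: "real^'n^'n"
  assumes "A \<ge> 0" "A *v x = \<nu> *\<^sub>R x" "x \<noteq> 0"
  shows "\<nu> \<le> spec_radius A"
  using perron_frobenius(2)[OF assms(1) real_eigenvalue_mem[OF assms(2,3)]] by simp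

text \<open>The Collatz-Wielandt lower bound: one nonnegative test vector, possibly with zero
  entries, bounds the spectral radius from below.\<close>

lemma spec_radius_ge_of_subinvariant:
  fixes A :: "real^'n^'n"
  assumes A: "A \<ge> 0" and "x \<ge> 0" "x \<noteq> 0" "A *v x \<ge> \<mu> *\<^sub>R x"
  shows "\<mu> \<le> spec_radius A"
proof (cases "\<mu> \<ge> 0")
  case True
  obtain \<nu> y where y: "\<nu> \<ge> \<mu>" "y \<ge> 0" "sum (($) y) UNIV = 1" "A *v y = \<nu> *\<^sub>R y"
    using nonneg_eigenvector_of_subinvariant[OF A assms(2,3) True assms(4)] .
  then have "y \<noteq> 0" by auto
  then show ?thesis using real_eigenvalue_le_spec_radius[OF A y(4)] y(1) by simp
qed (use perron_frobenius(3)[OF A] in simp)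

text \<open>A Perron vector of \<open>A\<close> is a test vector for \<open>B\<close>, since
  \<open>B x \<ge> A x\<close>.\<close>

lemma spec_radius_mono:
  fixes A B :: "real^'n^'n"
  assumes A: "A \<ge> 0" and AB: "A \<le> B"
  shows "spec_radius A \<le> spec_radius B"
proof -
  obtain x where x: "x \<ge> 0" "sum (($) x) UNIV = 1" "A *v x = spec_radius A *\<^sub>R x"
    using perron_frobenius(1)[OF A] by blast
  have "A *v x \<le> B *v x"
    using AB x(1) by (auto simp: less_eq_vec_def matrix_vector_mult_def intro!: sum_mono mult_right_mono)
  moreover have "B \<ge> 0" using A AB by (rule order_trans)
  moreover have "x \<noteq> 0" using x(2) by auto
  ultimately show ?thesis
    using x by (intro spec_radius_ge_of_subinvariant) auto
qed

text \<open>The negative part \<open>x\<^sup>-\<close> of \<open>x\<close> satisfies \<open>C x\<^sup>- \<ge> t x\<^sup>-\<close>.\<close>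

lemma inverse_positive:
  fixes C :: "real^'n^'n"
  assumes C: "C \<ge> 0" and t: "spec_radius C < t" and x: "t *\<^sub>R x - C *v x \<ge> 0"
  shows "x \<ge> 0"
proof (rule ccontr)
  assume neg: "\<not> x \<ge> 0"
  let ?y = "\<chi> i. max 0 (- x $ i)"
  obtain i where "x $ i < 0" using neg by (auto simp: less_eq_vec_def not_le)
  then have "?y $ i \<noteq> 0 $ i" by simp
  then have "?y \<noteq> 0" by metis
  moreover have y0: "?y \<ge> 0" by (simp add: less_eq_vec_def)
  moreover have "C *v ?y \<ge> t *\<^sub>R ?y"
    unfolding less_eq_vec_def
  proof
    fix i
    show "(t *\<^sub>R ?y) $ i \<le> (C *v ?y) $ i"
    \<comment> \<open>If \<open>x $ i < 0\<close>, then \<open>?y \<ge> - x\<close> gives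
      \<open>(C ?y)_i \<ge> - (C x)_i \<ge> - t x_i = t ?y_i\<close>. Otherwise
      \<open>?y $ i = 0\<close>.\<close>
    proof (cases "x $ i < 0")
      case True
      have "(C *v (- x)) $ i \<le> (C *v ?y) $ i"
        using nonneg_matrix_vector_mono[OF C, of "- x" ?y] by (simp add: less_eq_vec_def)
      moreover have "(C *v (- x)) $ i = - (C *v x) $ i"
        by (simp add: matrix_vector_mult_def sum_negf)
      moreover have "(C *v x) $ i \<le> t * x $ i"
        using x by (simp add: less_eq_vec_def)
      ultimately show ?thesis using True by (simp add: max_def)
    next
      case False
      then show ?thesis using nonneg_matrix_vector_mult[OF C y0] by (simp add: less_eq_vec_def)
    qed
  qed
  ultimately have "t \<le> spec_radius C"
    using C by (intro spec_radius_ge_of_subinvariant)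
  with t show False by simp
qed

text \<open>The least multiple \<open>c z\<close> above the Perron vector \<open>x\<close> touches
  it at some index \<open>i\<close>. There
  \<open>\<rho> x_i \<le> c (C z)_i < t c z_i = t x_i\<close>.\<close>

lemma spec_radius_less_of_strict_superinvariant:
  fixes C :: "real^'n^'n"
  assumes C: "C \<ge> 0" and z: "\<And>i. z $ i > 0" and lt: "\<And>i. (C *v z) $ i < t * z $ i"
  shows "spec_radius C < t"
proof -
  obtain x where x: "x \<ge> 0" "sum (($) x) UNIV = 1" "C *v x = spec_radius C *\<^sub>R x"
    using perron_frobenius(1)[OF C] by blast
  let ?q = "\<lambda>j. x $ j / z $ j"
  have "Max (range ?q) \<in> range ?q" by (intro Max_in) auto
  then obtain i where "Max (range ?q) = ?q i" by blast
  then have i: "?q j \<le> ?q i" for j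
    using Max_ge[of "range ?q" "?q j"] by simp
  let ?c = "x $ i / z $ i"
  have le: "x $ j \<le> ?c * z $ j" for j
    using i[of j] z[of j] by (simp add: field_simps)
  have c: "?c > 0"
  proof (rule ccontr)
    assume "\<not> ?c > 0"
    then have "x $ j \<le> 0" for j
      using le[of j] z[of j] by (smt (verit) mult_nonpos_nonneg)
    then have "sum (($) x) UNIV \<le> 0" by (simp add: sum_nonpos)
    with x(2) show False by simp
  qed
  have "spec_radius C * x $ i = (C *v x) $ i" using x(3) by simp
  also have "\<dots> \<le> (C *v (?c *\<^sub>R z)) $ i"
    using nonneg_matrix_vector_mono[OF C, of x "?c *\<^sub>R z"] le by (simp add: less_eq_vec_def)
  also have "\<dots> = ?c * (C *v z) $ i" by (simp add: matrix_vector_mult_scaleR)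
  also have "\<dots> < ?c * (t * z $ i)" by (intro mult_strict_left_mono c lt)
  also have "\<dots> = t * x $ i" using z[of i] by simp
  finally show ?thesis using c z[of i] by (simp add: zero_less_divide_iff)
qed

section \<open>Continuity of the spectral radius on nonnegative matrices\<close>

lemma tendsto_matrix_vector_mult_nth:
  fixes C :: "'a \<Rightarrow> real^'n^'m"
  assumes "(C \<longlongrightarrow> L) F"
  shows "((\<lambda>l. (C l *v x) $ i) \<longlongrightarrow> (L *v x) $ i) F"
  unfolding matrix_vector_mult_def by (auto intro!: tendsto_intros assms)

text \<open>Each one-sided bound comes from a fixed test vector built from \<open>L\<close>, whose
  strict inequalities persist for nearby \<open>C l\<close>.\<close>

theorem tendsto_spec_radius_nonneg:
  fixes C :: "'a \<Rightarrow> real^'n^'n"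
  assumes lim: "(C \<longlongrightarrow> L) F" and C: "\<forall>\<^sub>F l in F. C l \<ge> 0" and L: "L \<ge> 0"
  shows "((\<lambda>l. spec_radius (C l)) \<longlongrightarrow> spec_radius L) F"
proof (rule order_tendstoI)
  fix t assume t: "t < spec_radius L"
  obtain x where x: "x \<ge> 0" "sum (($) x) UNIV = 1" "L *v x = spec_radius L *\<^sub>R x"
    using perron_frobenius(1)[OF L] by blast
  have "x \<noteq> 0" using x(2) by auto
  \<comment> \<open>The gap below \<open>spec_radius L\<close> makes the inequality strict on the
    support of \<open>x\<close>. Off the support, \<open>C l \<ge> 0\<close> suffices.\<close>
  obtain t' where t': "t < t'" "t' < spec_radius L" using dense t by blast
  have "\<forall>\<^sub>F l in F. x $ i > 0 \<longrightarrow> t' * x $ i < (C l *v x) $ i" for i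
  proof (cases "x $ i > 0")
    case True
    then have "t' * x $ i < (L *v x) $ i" using t' x(3) by simp
    from order_tendstoD(1)[OF tendsto_matrix_vector_mult_nth[OF lim] this]
    show ?thesis by eventually_elim simp
  qed simp
  then have "\<forall>\<^sub>F l in F. \<forall>i. x $ i > 0 \<longrightarrow> t' * x $ i < (C l *v x) $ i"
    by (rule eventually_all_finite)
  with C show "\<forall>\<^sub>F l in F. t < spec_radius (C l)"
  proof eventually_elim
    case (elim l)
    have "C l *v x \<ge> t' *\<^sub>R x"
      unfolding less_eq_vec_def
    proof
      fix i
      show "(t' *\<^sub>R x) $ i \<le> (C l *v x) $ i"
      proof (cases "x $ i > 0")
        case False
        then have "x $ i = 0" using x(1) by (simp add: less_eq_vec_def order.antisym)
        then show ?thesis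
          using nonneg_matrix_vector_mult[OF elim(1) x(1)] by (simp add: less_eq_vec_def)
      qed (use elim(2) in \<open>auto intro: less_imp_le\<close>)
    qed
    then show ?case
      using spec_radius_ge_of_subinvariant[OF elim(1) x(1) \<open>x \<noteq> 0\<close>] t' by force
  qed
next
  fix t assume t: "spec_radius L < t"
  have t0: "t > 0" using perron_frobenius(3)[OF L] t by simp
  let ?f = "\<lambda>x. t *\<^sub>R x - L *v x"
  have lin: "linear ?f"
    by (intro linear_compose_sub linear_compose_scale_right linear_id[unfolded id_def]) auto
  have "inj ?f"
    unfolding linear_injective_0[OF lin]
    using real_eigenvalue_le_spec_radius[OF L, of _ t] t by force
  then have "surj ?f" using lin linear_injective_imp_surjective by blast
  \<comment> \<open>The test vector is \<open>z = (t I - L)\<^sup>-\<^sup>1 1\<close>, with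
    \<open>1\<close> the all-ones vector. From \<open>t z = 1 + L z\<close> come both its positivity
    and a margin of 1 in \<open>L z < t z\<close>.\<close>
  then obtain z where z: "?f z = 1" unfolding surj_def by metis
  have z0: "z \<ge> 0"
    by (rule inverse_positive[OF L t]) (simp only: z, simp add: less_eq_vec_def)
  have fz: "t * z $ i = 1 + (L *v z) $ i" for i
    using arg_cong[OF z, of "\<lambda>y. y $ i"] by simp
  have z_pos: "z $ i > 0" for i
  proof -
    have "(L *v z) $ i \<ge> 0" using nonneg_matrix_vector_mult[OF L z0] by (simp add: less_eq_vec_def)
    then have "t * z $ i > 0" using fz[of i] by simp
    then show ?thesis using t0 by (simp add: zero_less_mult_iff)
  qed
  have "\<forall>\<^sub>F l in F. (C l *v z) $ i < t * z $ i" for i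
    using order_tendstoD(2)[OF tendsto_matrix_vector_mult_nth[OF lim]] fz[of i] by simp
  then have "\<forall>\<^sub>F l in F. \<forall>i. (C l *v z) $ i < t * z $ i"
    by (rule eventually_all_finite)
  with C show "\<forall>\<^sub>F l in F. spec_radius (C l) < t"
    by eventually_elim (auto intro: spec_radius_less_of_strict_superinvariant z_pos)
qed

section \<open>Spectral radii of \<open>T\<close> and of
  \<open>(I - T)\<^sup>-\<^sup>1 T\<close>\<close>

text \<open>Here \<open>C = (I - T)\<^sup>-\<^sup>1 T\<close>.\<close>

context
  fixes T C :: "real^'n^'n"
  assumes T: "T \<ge> 0"
    and inj: "\<And>x. T *v x = x \<Longrightarrow> x = 0"
    and TC: "C - T ** C = T"
begin

lemma resolvent_mult_vector: "C *v x - T *v (C *v x) = T *v x"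
  by (metis TC matrix_vector_mul_assoc matrix_vector_mult_diff_rdistrib)

text \<open>\<open>I - T\<close> sends both \<open>(1 - \<rho>) C x\<close> and
  \<open>\<rho> x\<close> to \<open>\<rho> (1 - \<rho>) x\<close>, and it is injective. With
  \<open>\<rho> = 1\<close>, \<open>x\<close> would be a nonzero fixed point of
  \<open>T\<close>.\<close>

lemma resolvent_perron_vector:
  assumes "T *v x = \<rho> *\<^sub>R x" "x \<noteq> 0"
  shows "(1 - \<rho>) *\<^sub>R (C *v x) = \<rho> *\<^sub>R x" "\<rho> \<noteq> 1"
proof -
  let ?y = "(1 - \<rho>) *\<^sub>R (C *v x) - \<rho> *\<^sub>R x"
  have "T *v ?y = (1 - \<rho>) *\<^sub>R (C *v x - T *v x) - \<rho> *\<^sub>R (T *v x)"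
    by (simp add: matrix_vector_mult_diff_distrib matrix_vector_mult_scaleR
        flip: resolvent_mult_vector[of x])
  also have "\<dots> = ?y"
    unfolding assms(1) by (simp add: algebra_simps)
  finally have "?y = 0" by (rule inj)
  then show "(1 - \<rho>) *\<^sub>R (C *v x) = \<rho> *\<^sub>R x" by simp
  show "\<rho> \<noteq> 1" using inj[of x] assms by auto
qed

text \<open>Column by column: \<open>(I - T) C e_j = T e_j \<ge> 0\<close>, to which
  \<open>inverse_positive\<close> applies with \<open>t = 1\<close>.\<close>

lemma resolvent_nonneg:
  assumes "spec_radius T < 1"
  shows "C \<ge> 0"
proof -
  have "C *v axis j 1 \<ge> 0" for j
  proof (rule inverse_positive[OF T assms])
    have "T *v axis j 1 \<ge> 0"
      by (rule nonneg_matrix_vector_mult[OF T]) (simp add: less_eq_vec_def axis_def)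
    then show "0 \<le> 1 *\<^sub>R (C *v axis j 1) - T *v (C *v axis j 1)"
      using resolvent_mult_vector[of "axis j 1"] by simp
  qed
  then show ?thesis
    by (simp add: nonneg_matrix_iff matrix_vector_mul_component matrix_vector_mult_basis column_def less_eq_vec_def)
qed

text \<open>If \<open>\<rho>(T) > 1\<close>, the Perron vector \<open>x\<close> of \<open>T\<close> has \<open>C x = - \<rho> / (\<rho> - 1) x\<close>, whose entries sum to less
  than \<open>- 1\<close>.\<close>

lemma spec_radius_less_1_if:
  assumes C: "\<And>i j. C $ i $ j > - 1 / CARD('n)"
  shows "spec_radius T < 1"
proof (rule ccontr)
  assume "\<not> spec_radius T < 1"
  obtain x where x: "x \<ge> 0" "sum (($) x) UNIV = 1" "T *v x = spec_radius T *\<^sub>R x"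
    using perron_frobenius(1)[OF T] by blast
  let ?\<rho> = "spec_radius T"
  have "x \<noteq> 0" using x(2) by auto
  note r = resolvent_perron_vector[OF x(3) this]
  with \<open>\<not> ?\<rho> < 1\<close> have r1: "?\<rho> > 1" by simp
  \<comment> \<open>Each of the \<open>n\<close> entries of \<open>C x\<close> is at least
    \<open>- 1 / n\<close>, because the entries of \<open>x\<close> sum to 1.\<close>
  have "- 1 = (\<Sum>i\<in>(UNIV::'n set). - 1 / CARD('n) * sum (($) x) UNIV)"
    using x(2) by simp
  also have "\<dots> \<le> sum (($) (C *v x)) UNIV"
    unfolding matrix_vector_mult_def sum_distrib_left vec_lambda_beta
    using x(1) by (intro sum_mono mult_right_mono less_imp_le[OF C]) (simp add: less_eq_vec_def)
  finally have ge: "- 1 \<le> sum (($) (C *v x)) UNIV" .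
  have "(1 - ?\<rho>) * sum (($) (C *v x)) UNIV = sum (($) ((1 - ?\<rho>) *\<^sub>R (C *v x))) UNIV"
    by (simp add: sum_distrib_left)
  also have "\<dots> = ?\<rho>"
    unfolding r(1) using x(2) by (simp flip: sum_distrib_left)
  finally have "(1 - ?\<rho>) * sum (($) (C *v x)) UNIV = ?\<rho>" .
  \<comment> \<open>The left side equals \<open>- ?\<rho>\<close>, so this reads
    \<open>- ?\<rho> \<ge> 1 - ?\<rho>\<close>, which is absurd.\<close>
  moreover have "(?\<rho> - 1) * sum (($) (C *v x)) UNIV \<ge> (?\<rho> - 1) * - 1"
    using ge r1 by (intro mult_left_mono) auto
  ultimately show False by (simp add: algebra_simps)
qed

text \<open>A Perron vector of \<open>T\<close> is an eigenvector of \<open>C\<close> for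
  \<open>\<rho> / (1 - \<rho>)\<close>, and one of \<open>C\<close> is an eigenvector of
  \<open>T\<close> for \<open>\<sigma> / (1 + \<sigma>)\<close>. These maps are mutually inverse, so
  the two resulting bounds give equality.\<close>

lemma spec_radius_resolvent:
  assumes C: "C \<ge> 0"
  shows "spec_radius T < 1" "spec_radius T = spec_radius C / (1 + spec_radius C)"
proof -
  let ?\<rho> = "spec_radius T" and ?\<sigma> = "spec_radius C"
  show less: "?\<rho> < 1"
    using C by (intro spec_radius_less_1_if) (auto simp: nonneg_matrix_iff intro: less_le_trans[of _ 0])
  have s0: "?\<sigma> \<ge> 0" using perron_frobenius(3)[OF C] .
  obtain x where x: "x \<ge> 0" "sum (($) x) UNIV = 1" "T *v x = ?\<rho> *\<^sub>R x"
    using perron_frobenius(1)[OF T] by blast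
  have x0: "x \<noteq> 0" using x(2) by auto
  have "C *v x = (1 / (1 - ?\<rho>)) *\<^sub>R ((1 - ?\<rho>) *\<^sub>R (C *v x))" using less by simp
  also have "\<dots> = (?\<rho> / (1 - ?\<rho>)) *\<^sub>R x"
    unfolding resolvent_perron_vector(1)[OF x(3) x0] by simp
  finally have "?\<rho> / (1 - ?\<rho>) \<le> ?\<sigma>"
    by (rule real_eigenvalue_le_spec_radius[OF C _ x0])
  then have le: "?\<rho> \<le> ?\<sigma> / (1 + ?\<sigma>)"
    using less s0 by (simp add: field_simps)
  obtain y where y: "y \<ge> 0" "sum (($) y) UNIV = 1" "C *v y = ?\<sigma> *\<^sub>R y"
    using perron_frobenius(1)[OF C] by blast
  have y0: "y \<noteq> 0" using y(2) by auto
  have "(1 + ?\<sigma>) *\<^sub>R (T *v y) = ?\<sigma> *\<^sub>R y"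
    using resolvent_mult_vector[of y] y(3)
    by (simp add: matrix_vector_mult_scaleR scaleR_add_left diff_eq_eq)
  then have "(1 / (1 + ?\<sigma>)) *\<^sub>R ((1 + ?\<sigma>) *\<^sub>R (T *v y)) = (1 / (1 + ?\<sigma>)) *\<^sub>R (?\<sigma> *\<^sub>R y)"
    by simp
  then have "T *v y = (?\<sigma> / (1 + ?\<sigma>)) *\<^sub>R y"
    using s0 by simp
  then have "?\<sigma> / (1 + ?\<sigma>) \<le> ?\<rho>"
    by (rule real_eigenvalue_le_spec_radius[OF T _ y0])
  with le show "?\<rho> = ?\<sigma> / (1 + ?\<sigma>)" by simp
qed

end

section \<open>Both kinds of splitting satisfy the resolvent identity\<close>

text \<open>The quadratic form is \<open>|A x|^2 + l |x|^2\<close>, so the kernel is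
  trivial.\<close>

lemma invertible_regularized_gram:
  fixes A :: "real^'n^'m"
  assumes "l > 0"
  shows "invertible (regularized_gram A l)"
proof -
  have "x = 0" if "regularized_gram A l *v x = 0" for x
  proof -
    have "regularized_gram A l *v x = transpose A *v (A *v x) + l *\<^sub>R x"
      by (simp add: regularized_gram_def matrix_vector_mult_add_rdistrib matrix_vector_mul_assoc
          flip: scaleR_matrix_vector_assoc)
    then have "x \<bullet> (transpose A *v (A *v x)) + l * (x \<bullet> x) = 0"
      using that by (metis inner_add_right inner_scaleR_right inner_zero_right)
    moreover have "x \<bullet> (transpose A *v (A *v x)) = (A *v x) \<bullet> (A *v x)"
      by (metis dot_lmul_matrix inner_commute transpose_matrix_vector)
    ultimately have "l * (x \<bullet> x) \<le> 0" using inner_ge_zero[of "A *v x"] by linarith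
    then have "x \<bullet> x \<le> 0" using assms by (simp add: mult_le_0_iff)
    then show ?thesis by (metis antisym inner_eq_zero_iff inner_ge_zero)
  qed
  then show ?thesis
    using matrix_left_invertible_ker invertible_left_inverse by blast
qed

lemma matrix_inv_mult:
  fixes A :: "real^'n^'n"
  assumes "invertible A"
  shows "A ** matrix_inv A = mat 1" "matrix_inv A ** A = mat 1"
proof -
  have "\<exists>A'. A ** A' = mat 1 \<and> A' ** A = mat 1" using assms by (simp add: invertible_def)
  then have "A ** matrix_inv A = mat 1 \<and> matrix_inv A ** A = mat 1"
    unfolding matrix_inv_def by (rule someI_ex)
  then show "A ** matrix_inv A = mat 1" "matrix_inv A ** A = mat 1" by auto
qed

lemma matrix_mul_diff_left:
  fixes Y Z :: "real^'n^'m" and A :: "real^'k^'n"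
  shows "(Y - Z) ** A = Y ** A - Z ** A"
  by (simp add: matrix_matrix_mult_def vec_eq_iff sum_subtractf left_diff_distrib)

text \<open>Here \<open>I - U\<^sup>-\<^sup>1 V = U\<^sup>-\<^sup>1 B\<close> is invertible, and
  multiplying it by \<open>B\<^sup>-\<^sup>1 V\<close> gives
  \<open>U\<^sup>-\<^sup>1 V\<close>.\<close>

lemma weak_splitting_resolvent:
  fixes B U V :: "real^'n^'n"
  assumes "weak_splitting_first B U V" and B: "invertible B"
  shows "matrix_inv U ** V *v x = x \<Longrightarrow> x = 0"
    and "matrix_inv B ** V - (matrix_inv U ** V) ** (matrix_inv B ** V) = matrix_inv U ** V"
proof -
  have BUV: "B = U - V" and U: "invertible U"
    using assms(1) by (auto simp: weak_splitting_first_def)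
  have V: "V = U - B" using BUV by simp
  have *: "matrix_inv U ** V = mat 1 - matrix_inv U ** B"
    unfolding V by (simp add: matrix_mul_diff_right matrix_inv_mult(2)[OF U])
  show "x = 0" if "matrix_inv U ** V *v x = x"
  proof -
    have "(matrix_inv U ** B) *v x = 0"
      using that unfolding * by (simp add: matrix_vector_mult_diff_rdistrib)
    then have "(matrix_inv B ** U ** (matrix_inv U ** B)) *v x = 0"
      by (simp flip: matrix_vector_mul_assoc)
    moreover have "matrix_inv B ** U ** (matrix_inv U ** B) = mat 1"
      using matrix_inv_mult(1)[OF U] matrix_inv_mult(2)[OF B] by (metis matrix_mul_assoc matrix_mul_rid)
    ultimately show ?thesis by simp
  qed
  have "(mat 1 - matrix_inv U ** B) ** (matrix_inv B ** V)
      = matrix_inv B ** V - matrix_inv U ** B ** (matrix_inv B ** V)"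
    by (simp add: matrix_mul_diff_left)
  also have "matrix_inv U ** B ** (matrix_inv B ** V) = matrix_inv U ** V"
    using matrix_inv_mult(1)[OF B] by (metis matrix_mul_assoc matrix_mul_rid)
  finally show "matrix_inv B ** V - (matrix_inv U ** V) ** (matrix_inv B ** V) = matrix_inv U ** V"
    unfolding * by simp
qed

text \<open>Pseudoinverses do not cancel in general. Equal ranges make
  \<open>M M\<^sup>\<dagger>\<close> and \<open>A A\<^sup>\<dagger>\<close> fix \<open>N\<close>,
  and equal null spaces give
  \<open>M\<^sup>\<dagger> M A\<^sup>\<dagger> = A\<^sup>\<dagger>\<close>. Expanding
  \<open>M\<^sup>\<dagger> (M - A) A\<^sup>\<dagger> N\<close> then yields the identity.\<close>

lemma proper_splitting_resolvent:
  fixes A M N :: "real^'n^'m"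
  assumes "proper_splitting A M N"
  shows "moore_penrose M ** N *v x = x \<Longrightarrow> x = 0"
    and "moore_penrose A ** N - (moore_penrose M ** N) ** (moore_penrose A ** N) = moore_penrose M ** N"
proof -
  let ?A = "moore_penrose A" and ?M = "moore_penrose M"
  have AMN: "A = M - N" and ran: "range (\<lambda>x. A *v x) = range (\<lambda>x. M *v x)"
    and ker: "\<And>x. A *v x = 0 \<longleftrightarrow> M *v x = 0"
    using assms by (auto simp: proper_splitting_def)
  have N: "N = M - A" using AMN by simp
  have mpA: "A ** ?A ** A = A" "?A ** A ** ?A = ?A" "transpose (?A ** A) = ?A ** A"
    and mpM: "M ** ?M ** M = M" "transpose (?M ** M) = ?M ** M"
    using is_moore_penrose_moore_penrose[of A] is_moore_penrose_moore_penrose[of M]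
    unfolding is_moore_penrose_def by auto
  have fix_range: "P ** Z = Z"
    if PY: "P ** Y = Y" and YZ: "range (\<lambda>x. Y *v x) = range (\<lambda>x. Z *v x)" for P :: "real^'m^'m" and Y Z :: "real^'n^'m"
  proof -
    have "(P ** Z) *v x = Z *v x" for x
    proof -
      obtain w where "Z *v x = Y *v w" using YZ by (metis (mono_tags, lifting) rangeE rangeI)
      then show ?thesis using PY by (metis matrix_vector_mul_assoc)
    qed
    then show ?thesis by (simp add: matrix_eq)
  qed
  have MMA: "M ** ?M ** A = A" using fix_range[OF mpM(1)] ran by simp
  have AAM: "A ** ?A ** M = M" using fix_range[OF mpA(1)] ran by simp
  have AMM: "A ** (?M ** M) = A"
  proof -
    \<comment> \<open>The columns of \<open>M\<^sup>\<dagger> M - I\<close> lie in the null space of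
      \<open>M\<close>, hence in that of \<open>A\<close>.\<close>
    have "M ** (?M ** M - mat 1) = 0" using mpM(1) by (simp add: matrix_mul_diff_right matrix_mul_assoc)
    then have "A ** (?M ** M - mat 1) = 0"
      using ker unfolding matrix_eq by (simp flip: matrix_vector_mul_assoc)
    then show ?thesis by (simp add: matrix_mul_diff_right)
  qed
  have MMX: "?M ** M ** ?A = ?A"
  proof -
    \<comment> \<open>Both factors are symmetric, so transposing swaps their order.\<close>
    have "?A ** A ** (?M ** M) = ?A ** A" using AMM by (simp flip: matrix_mul_assoc)
    from arg_cong[OF this, of transpose] have "?M ** M ** (?A ** A) = ?A ** A"
      by (simp only: matrix_transpose_mul[of "?A ** A" "?M ** M"] mpA(3) mpM(2))
    then show ?thesis using mpA(2) by (metis matrix_mul_assoc)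
  qed
  have MMN: "M ** ?M ** N = N" and AAN: "A ** ?A ** N = N"
    unfolding N using mpM(1) MMA mpA(1) AAM by (simp_all add: matrix_mul_diff_right)
  show "x = 0" if "?M ** N *v x = x"
  proof -
    \<comment> \<open>A fixed point satisfies \<open>M x = N x\<close>, so \<open>A x = 0\<close>.
      The common null space gives \<open>N x = M x = 0\<close>, whence
      \<open>x = M\<^sup>\<dagger> N x = 0\<close>.\<close>
    have "M *v x = N *v x" using that MMN by (metis matrix_vector_mul_assoc)
    then have "A *v x = 0" unfolding AMN by (simp add: matrix_vector_mult_diff_rdistrib)
    then have "N *v x = 0" using ker \<open>M *v x = N *v x\<close> by auto
    then show ?thesis using that by (simp flip: matrix_vector_mul_assoc)
  qed
  have "?M ** N = ?M ** M - ?M ** A" unfolding N by (simp add: matrix_mul_diff_right)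
  then have "(?M ** N) ** (?A ** N) = ?M ** M ** (?A ** N) - ?M ** A ** (?A ** N)"
    by (simp add: matrix_mul_diff_left)
  moreover have "?M ** M ** (?A ** N) = ?A ** N" using MMX by (metis matrix_mul_assoc)
  moreover have "?M ** A ** (?A ** N) = ?M ** N" using AAN by (metis matrix_mul_assoc)
  ultimately show "?A ** N - (?M ** N) ** (?A ** N) = ?M ** N" by simp
qed

section \<open>Passage to the limit and comparison with the given splitting\<close>

theorem theorem3p2:
  fixes A M N :: "real^'n^'m"
    and Ml Nl :: "real \<Rightarrow> real^'n^'n"
    and L :: "real^'n^'n"
  assumes "weak_proper_splitting_first A M N"
    and "\<And>l. l > 0 \<Longrightarrow> weak_splitting_first (regularized_gram A l) (Ml l) (Nl l)"
    and "((\<lambda>l. matrix_inv (regularized_gram A l) ** Nl l) \<longlongrightarrow> L) (at_right 0)"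
    and "moore_penrose A ** N \<ge> L"
    and "L \<ge> 0"
  shows "\<exists>r. ((\<lambda>l. spec_radius (matrix_inv (Ml l) ** Nl l)) \<longlongrightarrow> r) (at_right 0) \<and>
             r \<le> spec_radius (moore_penrose M ** N) \<and>
             spec_radius (moore_penrose M ** N) < 1"
proof -
  define C where "C = (\<lambda>l. matrix_inv (regularized_gram A l) ** Nl l)"
  define T where "T = (\<lambda>l. matrix_inv (Ml l) ** Nl l)"
  let ?D = "moore_penrose A ** N" and ?S = "moore_penrose M ** N"
  have S: "?S \<ge> 0" and ps: "proper_splitting A M N"
    using assms(1) by (auto simp: weak_proper_splitting_first_def)
  have D: "?D \<ge> 0" using assms(4,5) by order
  note SD = spec_radius_resolvent[OF S proper_splitting_resolvent[OF ps] D]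
  have T: "T l \<ge> 0" if "l > 0" for l
    using assms(2)[OF that] by (simp add: weak_splitting_first_def T_def)
  have inj: "T l *v x = x \<Longrightarrow> x = 0" and eq: "C l - T l ** C l = T l" if "l > 0" for l x
    using weak_splitting_resolvent[OF assms(2)[OF that] invertible_regularized_gram[OF that]]
    by (auto simp: T_def C_def)
  have lim: "(C \<longlongrightarrow> L) (at_right 0)" using assms(3) by (simp add: C_def)
  \<comment> \<open>Convergence to \<open>L \<ge> 0\<close> does not make \<open>C l\<close>
    nonnegative, but it gives this weaker bound, from which \<open>spec_radius (T l) < 1\<close> and
    then \<open>C l \<ge> 0\<close> follow.\<close>
  have "\<forall>\<^sub>F l in at_right 0. C l $ i $ j > - 1 / CARD('n)" for i j
  proof (rule order_tendstoD(1))
    show "((\<lambda>l. C l $ i $ j) \<longlongrightarrow> L $ i $ j) (at_right 0)"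
      by (intro tendsto_vec_nth lim)
    have "L $ i $ j \<ge> 0" using assms(5) by (simp add: nonneg_matrix_iff)
    moreover have "- 1 / real CARD('n) < 0" by simp
    ultimately show "- 1 / real CARD('n) < L $ i $ j" by linarith
  qed
  then have "\<forall>\<^sub>F l in at_right 0. \<forall>i j. C l $ i $ j > - 1 / CARD('n)"
    by (intro eventually_all_finite)
  then have ev: "\<forall>\<^sub>F l in at_right 0. C l \<ge> 0 \<and> l > 0"
    using eventually_at_right_less[of 0]
  proof eventually_elim
    case (elim l)
    have "spec_radius (T l) < 1"
      using elim(1) by (intro spec_radius_less_1_if[OF T[OF elim(2)] inj[OF elim(2)] eq[OF elim(2)]]) auto
    then show ?case
      using resolvent_nonneg[OF T[OF elim(2)] inj[OF elim(2)] eq[OF elim(2)]] elim(2) by blast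
  qed
  let ?r = "spec_radius L / (1 + spec_radius L)"
  have L0: "spec_radius L \<ge> 0" using perron_frobenius(3)[OF assms(5)] .
  have "((\<lambda>l. spec_radius (C l)) \<longlongrightarrow> spec_radius L) (at_right 0)"
    by (rule tendsto_spec_radius_nonneg[OF lim _ assms(5)]) (use ev in \<open>auto elim: eventually_mono\<close>)
  then have "((\<lambda>l. spec_radius (C l) / (1 + spec_radius (C l))) \<longlongrightarrow> ?r) (at_right 0)"
    using L0 by (intro tendsto_intros) auto
  moreover have "\<forall>\<^sub>F l in at_right 0. spec_radius (C l) / (1 + spec_radius (C l)) = spec_radius (T l)"
    using ev
  proof eventually_elim
    case (elim l)
    then have l: "l > 0" and Cl: "C l \<ge> 0" by auto
    show ?case using spec_radius_resolvent(2)[OF T[OF l] inj[OF l] eq[OF l] Cl] by simp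
  qed
  ultimately have "((\<lambda>l. spec_radius (T l)) \<longlongrightarrow> ?r) (at_right 0)"
    by (rule Lim_transform_eventually)
  moreover have "?r \<le> spec_radius ?S"
  proof -
    have "spec_radius L \<le> spec_radius ?D" by (rule spec_radius_mono[OF assms(5,4)])
    \<comment> \<open>The map \<open>s / (1 + s)\<close> is increasing for
      \<open>s \<ge> 0\<close>.\<close>
    then have "?r \<le> spec_radius ?D / (1 + spec_radius ?D)"
      using L0 by (simp add: field_simps)
    also have "\<dots> = spec_radius ?S" using SD(2) by simp
    finally show ?thesis .
  qed
  ultimately show ?thesis using SD(1) unfolding T_def by blast
qed

end
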